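(* Let $M,N,P\ge 2$ be pairwise coprime integers. Then the commutator subgroup of the triangle Artin group $\mathrm{Art}_{MNP}$ is perfect. In particular, $\mathrm{Art}_{MNP}$ is not poly-free.
   Context: For integers $2\le M,N,P<\infty$, the triangle Artin group is $\mathrm{Art}_{MNP}=\langle a,b,c\mid \{a,b\}_M=\{b,a\}_M,\ \{b,c\}_N=\{c,b\}_N,\ \{c,a\}_P=\{a,c\}_P\rangle$, where $\{a,b\}_M$ denotes the alternating word $aba\cdots$ of length $M$ starting with $a$. A group is perfect if it equals its own commutator subgroup. A group $G$ is poly-free if there is a finite subnormal sequence $1=G_0\trianglelefteq G_1\trianglelefteq\cdots\trianglelefteq G_n=G$ with each $G_{i+1}/G_i$ free (of possibly infinite rank). *)

theory Defs
  imports "HOL-Algebra.Algebra"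
begin

section \<open>Free groups\<close>

text \<open>
  A letter \<open>(x, True)\<close> stands for the generator \<open>x\<close> and \<open>(x, False)\<close> for its formal inverse.
  The free group on \<open>S\<close> consists of the words in the letters over \<open>S\<close>, taken modulo insertion and
  deletion of adjacent mutually inverse letters.
\<close>

type_synonym 'a word = "('a \<times> bool) list"

definition words :: "'a set \<Rightarrow> 'a word set"
  where "words S = lists (S \<times> UNIV)"

inductive_set free_rel :: "'a set \<Rightarrow> ('a word \<times> 'a word) set" for S :: "'a set"
  where
    refl: "w \<in> words S \<Longrightarrow> (w, w) \<in> free_rel S"
  | sym: "(v, w) \<in> free_rel S \<Longrightarrow> (w, v) \<in> free_rel S"
  | trans: "(u, v) \<in> free_rel S \<Longrightarrow> (v, w) \<in> free_rel S \<Longrightarrow> (u, w) \<in> free_rel S"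
  | cancel: "u \<in> words S \<Longrightarrow> v \<in> words S \<Longrightarrow> x \<in> S \<Longrightarrow>
      (u @ [(x, e), (x, \<not> e)] @ v, u @ v) \<in> free_rel S"

definition free_group :: "'a set \<Rightarrow> 'a word set monoid"
  where "free_group S =
    \<lparr>carrier = words S // free_rel S,
     monoid.mult = (\<lambda>A B. \<Union>u\<in>A. \<Union>v\<in>B. free_rel S `` {u @ v}),
     one = free_rel S `` {[]}\<rparr>"

text \<open>
  The basis may be infinite. It is no restriction to take it inside the element type of \<open>G\<close>,
  since a basis of \<open>G\<close> is a subset of \<open>carrier G\<close>.
\<close>

definition is_free_group :: "('a, 'b) monoid_scheme \<Rightarrow> bool"
  where "is_free_group G \<longleftrightarrow> (\<exists>S :: 'a set. free_group S \<cong> G)"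

section \<open>Group presentations\<close>

definition normal_closure :: "('a, 'b) monoid_scheme \<Rightarrow> 'a set \<Rightarrow> 'a set"
  where "normal_closure G R = \<Inter>{N. N \<lhd> G \<and> R \<subseteq> N}"

text \<open>A pair \<open>(l, r)\<close> of words stands for the relation \<open>l = r\<close>, i.e. for the relator \<open>l r\<inverse>\<close>.\<close>

definition relators :: "'a set \<Rightarrow> ('a word \<times> 'a word) set \<Rightarrow> 'a word set set"
  where "relators S R =
    {free_rel S `` {l} \<otimes>\<^bsub>free_group S\<^esub> inv\<^bsub>free_group S\<^esub> (free_rel S `` {r}) | l r. (l, r) \<in> R}"

definition presented_group :: "'a set \<Rightarrow> ('a word \<times> 'a word) set \<Rightarrow> 'a word set set monoid"
  where "presented_group S R = free_group S Mod normal_closure (free_group S) (relators S R)"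

section \<open>Triangle Artin groups\<close>

fun alternating :: "'a \<Rightarrow> 'a \<Rightarrow> nat \<Rightarrow> 'a word"
  where
    "alternating x y 0 = []"
  | "alternating x y (Suc n) = (x, True) # alternating y x n"

datatype artin_gen = Gen_a | Gen_b | Gen_c

definition triangle_artin :: "nat \<Rightarrow> nat \<Rightarrow> nat \<Rightarrow> artin_gen word set set monoid"
  where "triangle_artin M N P = presented_group {Gen_a, Gen_b, Gen_c}
    {(alternating Gen_a Gen_b M, alternating Gen_b Gen_a M),
     (alternating Gen_b Gen_c N, alternating Gen_c Gen_b N),
     (alternating Gen_c Gen_a P, alternating Gen_a Gen_c P)}"

section \<open>Perfect and poly-free groups\<close>

definition perfect_group :: "('a, 'b) monoid_scheme \<Rightarrow> bool"
  where "perfect_group G \<longleftrightarrow> group G \<and> derived G (carrier G) = carrier G"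

abbreviation commutator_subgroup :: "('a, 'b) monoid_scheme \<Rightarrow> ('a, 'b) monoid_scheme"
  where "commutator_subgroup G \<equiv> G\<lparr>carrier := derived G (carrier G)\<rparr>"

definition poly_free :: "('a, 'b) monoid_scheme \<Rightarrow> bool"
  where "poly_free G \<longleftrightarrow>
    (\<exists>(n :: nat) (H :: nat \<Rightarrow> 'a set).
      H 0 = {\<one>\<^bsub>G\<^esub>} \<and> H n = carrier G \<and>
      (\<forall>i<n. H i \<lhd> G\<lparr>carrier := H (Suc i)\<rparr> \<and>
             is_free_group (G\<lparr>carrier := H (Suc i)\<rparr> Mod H i)))"

section \<open>The groups above are groups\<close>

lemma words_append [simp]: "u @ v \<in> words S \<longleftrightarrow> u \<in> words S \<and> v \<in> words S"
  by (auto simp: words_def)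

lemma free_rel_words: "(u, v) \<in> free_rel S \<Longrightarrow> u \<in> words S \<and> v \<in> words S"
  by (induction rule: free_rel.induct) (auto simp: words_def)

lemma equiv_free_rel: "equiv (words S) (free_rel S)"
  by (rule equivI)
    (auto simp: refl_on_def sym_def trans_def dest: free_rel_words
      intro: free_rel.refl free_rel.sym free_rel.trans)

lemma free_rel_append_right:
  "(u, v) \<in> free_rel S \<Longrightarrow> w \<in> words S \<Longrightarrow> (u @ w, v @ w) \<in> free_rel S"
proof (induction rule: free_rel.induct)
  case (cancel u v x e)
  then show ?case using free_rel.cancel[of u S "v @ w" x e] by simp
qed (auto intro: free_rel.refl free_rel.sym free_rel.trans)

lemma free_rel_append_left:
  "(u, v) \<in> free_rel S \<Longrightarrow> w \<in> words S \<Longrightarrow> (w @ u, w @ v) \<in> free_rel S"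
proof (induction rule: free_rel.induct)
  case (cancel u v x e)
  then show ?case using free_rel.cancel[of "w @ u" S v x e] by simp
qed (auto intro: free_rel.refl free_rel.sym free_rel.trans)

lemma free_group_mult:
  assumes "u \<in> words S" "v \<in> words S"
  shows "free_rel S `` {u} \<otimes>\<^bsub>free_group S\<^esub> free_rel S `` {v} = free_rel S `` {u @ v}"
proof -
  have "congruent2 (free_rel S) (free_rel S) (\<lambda>u v. free_rel S `` {u @ v})"
    by (rule congruent2I[OF equiv_free_rel equiv_free_rel])
      (auto intro!: equiv_class_eq[OF equiv_free_rel] free_rel_append_left free_rel_append_right)
  then show ?thesis
    using UN_equiv_class2[OF equiv_free_rel equiv_free_rel] assms by (simp add: free_group_def)
qed

lemma free_rel_inverse:
  assumes "w \<in> words S"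
  shows "(rev (map (apsnd Not) w) @ w, []) \<in> free_rel S"
  using assms
proof (induction w)
  case Nil
  then show ?case by (simp add: free_rel.refl words_def)
next
  case (Cons l w)
  obtain x e where l: "l = (x, e)" by (cases l)
  have x: "x \<in> S" and w: "w \<in> words S" using Cons.prems by (auto simp: words_def l)
  have "rev (map (apsnd Not) w) \<in> words S" using w by (fastforce simp: words_def)
  from free_rel.cancel[OF this w x, of "\<not> e"] Cons.IH[OF w] show ?case
    by (auto simp: l intro: free_rel.trans)
qed

theorem group_free_group: "group (free_group S)"
proof (rule groupI)
  have car: "\<exists>w\<in>words S. A = free_rel S `` {w}" if "A \<in> carrier (free_group S)" for A
    using that by (auto simp: free_group_def elim!: quotientE)
  have inC: "free_rel S `` {w} \<in> carrier (free_group S)" if "w \<in> words S" for w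
    using that by (auto simp: free_group_def intro: quotientI)
  have one: "\<one>\<^bsub>free_group S\<^esub> = free_rel S `` {[]}" by (simp add: free_group_def)
  have Nil: "[] \<in> words S" by (simp add: words_def)
  show "\<one>\<^bsub>free_group S\<^esub> \<in> carrier (free_group S)" using inC[OF Nil] one by simp
  fix A assume A: "A \<in> carrier (free_group S)"
  then obtain u where u: "u \<in> words S" "A = free_rel S `` {u}" using car by blast
  show "\<one>\<^bsub>free_group S\<^esub> \<otimes>\<^bsub>free_group S\<^esub> A = A" using u Nil by (simp add: one free_group_mult)
  have u': "rev (map (apsnd Not) u) \<in> words S" using u(1) by (fastforce simp: words_def)
  have "free_rel S `` {rev (map (apsnd Not) u)} \<otimes>\<^bsub>free_group S\<^esub> A = \<one>\<^bsub>free_group S\<^esub>"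
    using u u' equiv_class_eq[OF equiv_free_rel free_rel_inverse] by (simp add: one free_group_mult)
  then show "\<exists>B\<in>carrier (free_group S). B \<otimes>\<^bsub>free_group S\<^esub> A = \<one>\<^bsub>free_group S\<^esub>"
    using inC[OF u'] by blast
  fix B assume B: "B \<in> carrier (free_group S)"
  then obtain v where v: "v \<in> words S" "B = free_rel S `` {v}" using car by blast
  show "A \<otimes>\<^bsub>free_group S\<^esub> B \<in> carrier (free_group S)" using u v inC by (simp add: free_group_mult)
  fix C assume "C \<in> carrier (free_group S)"
  then obtain w where w: "w \<in> words S" "C = free_rel S `` {w}" using car by blast
  show "A \<otimes>\<^bsub>free_group S\<^esub> B \<otimes>\<^bsub>free_group S\<^esub> C = A \<otimes>\<^bsub>free_group S\<^esub> (B \<otimes>\<^bsub>free_group S\<^esub> C)"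
    using u v w by (simp add: free_group_mult)
qed

lemma (in group) normal_closure_normal:
  assumes "R \<subseteq> carrier G"
  shows "normal_closure G R \<lhd> G"
proof (rule normal_invI)
  have "carrier G \<lhd> G" by (rule normal_invI) (auto intro: subgroup_self)
  then show "subgroup (normal_closure G R) G"
    unfolding normal_closure_def using assms
    by (intro subgroups_Inter) (auto intro: normal_imp_subgroup)
  fix x h assume "x \<in> carrier G" "h \<in> normal_closure G R"
  then show "x \<otimes> h \<otimes> inv x \<in> normal_closure G R"
    by (auto simp: normal_closure_def intro: normal.inv_op_closed2)
qed

theorem group_presented_group:
  assumes "\<And>l r. (l, r) \<in> R \<Longrightarrow> l \<in> words S \<and> r \<in> words S"
  shows "group (presented_group S R)"
proof -
  interpret group "free_group S" by (rule group_free_group)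
  have "free_rel S `` {w} \<in> carrier (free_group S)" if "w \<in> words S" for w
    using that by (auto simp: free_group_def intro: quotientI)
  then have "relators S R \<subseteq> carrier (free_group S)"
    using assms by (fastforce simp: relators_def)
  then show ?thesis
    unfolding presented_group_def
    by (intro normal.factorgroup_is_group normal_closure_normal)
qed

lemma alternating_words: "x \<in> S \<Longrightarrow> y \<in> S \<Longrightarrow> alternating x y n \<in> words S"
  by (induction x y n rule: alternating.induct) (auto simp: words_def)

corollary group_triangle_artin: "group (triangle_artin M N P)"
  unfolding triangle_artin_def
  by (rule group_presented_group) (auto intro: alternating_words)

end

theory Submission
  imports Defs
begin

text \<open>
  Let \<open>G\<close> be the Artin group with generators \<open>a\<close>, \<open>b\<close>, \<open>c\<close>, and \<open>G'\<close>, \<open>G''\<close> the first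
  two terms of its derived series.

  \<^emph>\<open>The commutator subgroup is perfect.\<close> Suppose that in a quotient of \<open>G\<close> the differences
  \<open>d = b a\<inverse>\<close> and \<open>e = c b\<inverse>\<close> lie in an abelian normal subgroup \<open>A\<close>. The three generators then act
  on \<open>A\<close> by the same automorphism \<open>\<tau>\<close>. With \<open>s = - \<tau>\<close> and
  \<open>[n] = 1 + s + \<dots> + s\<^bsup>n - 1\<^esup>\<close>, the defining relations say exactly that
  \<open>[M] d = 0\<close>, \<open>[N] e = 0\<close> and \<open>[P] (d + e) = 0\<close> (\<open>alternating_quotient\<close>). For coprime \<open>m\<close> and \<open>n\<close>
  the elements \<open>[m]\<close> and \<open>[n]\<close> generate the unit ideal of \<open>\<int>[s]\<close>, by the Euclidean algorithm, and
  this forces \<open>d = e = 0\<close> (\<open>geom_sum_three\<close>). Applied to the abelian group \<open>G / G'\<close>, this shows that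
  \<open>a\<close>, \<open>b\<close>, \<open>c\<close> agree modulo \<open>G'\<close>; applied then to \<open>G / G''\<close> with \<open>A = G' / G''\<close>, it shows that
  they agree modulo \<open>G''\<close> (\<open>triangle_relations_derived\<close>). Hence \<open>G / G''\<close> is cyclic, and \<open>G' = G''\<close>.

  \<^emph>\<open>The group is not poly-free.\<close> Let \<open>K = G'\<close>, which is perfect with cyclic quotient \<open>G / K\<close>. If a
  subgroup \<open>L\<close> containing \<open>K\<close> maps onto a free group, then the abelianization of that free group is
  a quotient of the cyclic group \<open>L / K\<close>, so the rank is at most one; the free group is abelian
  and the map kills \<open>K\<close>. So in a poly-free series \<open>K\<close> lies in every term
  (\<open>perfect_subset_free_quotient\<close>), and \<open>K\<close> is trivial. It remains to see that \<open>G\<close> is not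
  abelian. All metabelian quotients of \<open>G\<close> are abelian by the first part, so a genuinely larger
  quotient is needed: the reflection representation of the Coxeter group with labels \<open>M\<close>, \<open>N\<close>, \<open>P\<close>
  serves (\<open>reflection_relation\<close>, \<open>reflections_noncommuting\<close>).
\<close>

section \<open>Values of words and homomorphisms out of free groups\<close>

primrec word_value :: "('g, 'm) monoid_scheme \<Rightarrow> ('a \<Rightarrow> 'g) \<Rightarrow> 'a word \<Rightarrow> 'g"
  where
    "word_value G f [] = \<one>\<^bsub>G\<^esub>"
  | "word_value G f (l # w) =
      (if snd l then f (fst l) else inv\<^bsub>G\<^esub> f (fst l)) \<otimes>\<^bsub>G\<^esub> word_value G f w"

lemma words_Nil [simp]: "[] \<in> words S"
  by (simp add: words_def)

lemma words_Cons [simp]: "l # w \<in> words S \<longleftrightarrow> fst l \<in> S \<and> w \<in> words S"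
  by (cases l) (auto simp: words_def)

context group
begin

lemma word_value_closed [simp]:
  "f \<in> S \<rightarrow> carrier G \<Longrightarrow> w \<in> words S \<Longrightarrow> word_value G f w \<in> carrier G"
  by (induction w) auto

lemma word_value_append:
  assumes "f \<in> S \<rightarrow> carrier G" "u \<in> words S" "v \<in> words S"
  shows "word_value G f (u @ v) = word_value G f u \<otimes> word_value G f v"
  using assms(2)
proof (induction u)
  case (Cons l u)
  then have "f (fst l) \<in> carrier G" using assms(1) by auto
  with Cons assms show ?case by (auto simp: m_assoc)
qed (use assms in simp)

lemma word_value_free_rel:
  assumes "f \<in> S \<rightarrow> carrier G" and "(u, v) \<in> free_rel S"
  shows "word_value G f u = word_value G f v"
  using assms(2)
proof (induction rule: free_rel.induct)
  case (cancel u v x e)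
  then have "f x \<in> carrier G" using assms(1) by auto
  then have "word_value G f ([(x, e), (x, \<not> e)] @ v) = word_value G f v"
    using cancel assms(1) by (auto simp: m_assoc[symmetric])
  then show ?case using cancel assms(1) by (simp add: word_value_append[OF assms(1)] del: append.simps)
qed auto

end

lemma (in group_hom) hom_word_value:
  assumes "f \<in> S \<rightarrow> carrier G" "w \<in> words S"
  shows "h (word_value G f w) = word_value H (\<lambda>x. h (f x)) w"
  using assms(2)
proof (induction w)
  case (Cons l w)
  then have "f (fst l) \<in> carrier G" using assms(1) by auto
  with Cons assms show ?case by auto
qed simp

definition free_gen :: "'a set \<Rightarrow> 'a \<Rightarrow> 'a word set"
  where "free_gen S x = free_rel S `` {[(x, True)]}"

lemma carrier_free_group: "carrier (free_group S) = (\<lambda>w. free_rel S `` {w}) ` words S"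
  by (auto simp: free_group_def quotient_def)

lemma one_free_group: "\<one>\<^bsub>free_group S\<^esub> = free_rel S `` {[]}"
  by (simp add: free_group_def)

lemma free_gen_closed: "free_gen S \<in> S \<rightarrow> carrier (free_group S)"
  by (auto simp: free_gen_def carrier_free_group)

lemma word_value_free_gen:
  assumes "w \<in> words S"
  shows "word_value (free_group S) (free_gen S) w = free_rel S `` {w}"
  using assms
proof (induction w)
  case Nil
  then show ?case by (simp add: one_free_group)
next
  case (Cons l w)
  interpret F: group "free_group S" by (rule group_free_group)
  obtain x e where l: "l = (x, e)" by (cases l)
  have x: "x \<in> S" using Cons.prems l by simp
  have "free_rel S `` {[(x, False)]} \<otimes>\<^bsub>free_group S\<^esub> free_gen S x = \<one>\<^bsub>free_group S\<^esub>"
    using x free_rel.cancel[of "[]" S "[]" x False]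
    by (auto simp: free_gen_def free_group_mult one_free_group intro!: equiv_class_eq[OF equiv_free_rel])
  then have "inv\<^bsub>free_group S\<^esub> (free_gen S x) = free_rel S `` {[(x, False)]}"
    using x by (intro F.inv_equality) (auto simp: carrier_free_group free_gen_def)
  with Cons x show ?case
    by (auto simp: l free_gen_def free_group_mult)
qed

text \<open>
  The universal property of the free group: any assignment of the letters extends to a
  homomorphism, because the value of a word does not change along \<open>free_rel\<close>.
\<close>

lemma free_group_extend:
  assumes "group T" and f: "f \<in> S \<rightarrow> carrier T"
  obtains h where "h \<in> hom (free_group S) T"
    and "\<And>w. w \<in> words S \<Longrightarrow> h (free_rel S `` {w}) = word_value T f w"
proof
  interpret T: group T by fact
  define h where "h A = the_elem (word_value T f ` A)" for A
  show lift_word: "h (free_rel S `` {w}) = word_value T f w" if "w \<in> words S" for w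
  proof -
    have "word_value T f v = word_value T f w" if "v \<in> free_rel S `` {w}" for v
      using T.word_value_free_rel[OF f, of w v] that by simp
    moreover have "w \<in> free_rel S `` {w}" using free_rel.refl[OF that] by simp
    ultimately have "word_value T f ` (free_rel S `` {w}) = {word_value T f w}" by blast
    then show ?thesis by (simp add: h_def)
  qed
  show "h \<in> hom (free_group S) T"
  proof (rule homI)
    fix A B assume "A \<in> carrier (free_group S)" "B \<in> carrier (free_group S)"
    then obtain u v where "u \<in> words S" "A = free_rel S `` {u}" "v \<in> words S" "B = free_rel S `` {v}"
      by (auto simp: carrier_free_group)
    then show "h (A \<otimes>\<^bsub>free_group S\<^esub> B) = h A \<otimes>\<^bsub>T\<^esub> h B" and "h A \<in> carrier T"
      using T.word_value_closed[OF f] T.word_value_append[OF f]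
      by (simp_all add: free_group_mult lift_word)
  qed
qed

section \<open>Presented groups\<close>

definition presented_gen :: "'a set \<Rightarrow> ('a word \<times> 'a word) set \<Rightarrow> 'a \<Rightarrow> 'a word set set"
  where "presented_gen S R x =
    normal_closure (free_group S) (relators S R) #>\<^bsub>free_group S\<^esub> free_gen S x"

context
  fixes S :: "'a set" and R :: "('a word \<times> 'a word) set"
  assumes relation_words: "\<And>l r. (l, r) \<in> R \<Longrightarrow> l \<in> words S \<and> r \<in> words S"
begin

lemma relators_subset: "relators S R \<subseteq> carrier (free_group S)"
proof -
  interpret group "free_group S" by (rule group_free_group)
  have "free_rel S `` {w} \<in> carrier (free_group S)" if "w \<in> words S" for w
    using that by (auto simp: carrier_free_group)
  then show ?thesis using relation_words by (force simp: relators_def)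
qed

lemma normal_closure_relators_normal:
  "normal_closure (free_group S) (relators S R) \<lhd> free_group S"
  by (rule group.normal_closure_normal[OF group_free_group relators_subset])

lemma presented_projection:
  "(\<lambda>g. normal_closure (free_group S) (relators S R) #>\<^bsub>free_group S\<^esub> g)
    \<in> hom (free_group S) (presented_group S R)"
  unfolding presented_group_def by (rule normal.r_coset_hom_Mod[OF normal_closure_relators_normal])

lemma group_presented: "group (presented_group S R)"
  using relation_words by (rule group_presented_group)

lemma presented_gen_closed: "presented_gen S R \<in> S \<rightarrow> carrier (presented_group S R)"
  using presented_projection free_gen_closed[of S] by (force simp: presented_gen_def hom_def)

lemma word_value_presented_gen:
  assumes "w \<in> words S"
  shows "word_value (presented_group S R) (presented_gen S R) w =
    normal_closure (free_group S) (relators S R) #>\<^bsub>free_group S\<^esub> (free_rel S `` {w})"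
proof -
  interpret group_hom "free_group S" "presented_group S R"
    "\<lambda>g. normal_closure (free_group S) (relators S R) #>\<^bsub>free_group S\<^esub> g"
    using group_free_group group_presented presented_projection
    by (simp add: group_hom_def group_hom_axioms_def)
  show ?thesis
    using hom_word_value[OF free_gen_closed assms] assms
    by (simp add: word_value_free_gen presented_gen_def[abs_def])
qed

lemma presented_group_generated:
  assumes "g \<in> carrier (presented_group S R)"
  obtains w where "w \<in> words S" "g = word_value (presented_group S R) (presented_gen S R) w"
proof -
  obtain w where "w \<in> words S"
    "g = normal_closure (free_group S) (relators S R) #>\<^bsub>free_group S\<^esub> (free_rel S `` {w})"
    using assms by (auto simp: presented_group_def carrier_FactGroup carrier_free_group)
  then show thesis using that word_value_presented_gen by simp
qed

lemma presented_group_relation: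
  assumes "(l, r) \<in> R"
  shows "word_value (presented_group S R) (presented_gen S R) l =
    word_value (presented_group S R) (presented_gen S R) r"
proof -
  let ?F = "free_group S" and ?N = "normal_closure (free_group S) (relators S R)"
  interpret F: group ?F by (rule group_free_group)
  interpret N: normal ?N ?F by (rule normal_closure_relators_normal)
  have w: "l \<in> words S" "r \<in> words S" using relation_words assms by auto
  let ?l = "free_rel S `` {l}" and ?r = "free_rel S `` {r}"
  have lr: "?l \<in> carrier ?F" "?r \<in> carrier ?F" using w by (auto simp: carrier_free_group)
  have "?l \<otimes>\<^bsub>?F\<^esub> inv\<^bsub>?F\<^esub> ?r \<in> ?N"
    using assms by (auto simp: normal_closure_def relators_def)
  then have "?l \<in> ?N #>\<^bsub>?F\<^esub> ?r" using lr N.rcos_module_rev[OF F.is_group] by simp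
  then have "?N #>\<^bsub>?F\<^esub> ?r = ?N #>\<^bsub>?F\<^esub> ?l"
    by (rule F.repr_independence) (use lr N.subgroup_axioms in auto)
  then show ?thesis using w by (simp add: word_value_presented_gen)
qed

text \<open>
  The universal property in a form that avoids constructing the induced homomorphism: the
  homomorphism from the free group has a normal kernel containing the relators, hence containing
  their normal closure, so words that agree in the presented group agree in every group in which
  the relations hold. Contrapositively, any such group can serve to tell elements apart.
\<close>

lemma presented_group_universal:
  assumes "group T" and f: "f \<in> S \<rightarrow> carrier T"
    and rel: "\<And>l r. (l, r) \<in> R \<Longrightarrow> word_value T f l = word_value T f r"
    and w: "u \<in> words S" "v \<in> words S"
    and eq: "word_value (presented_group S R) (presented_gen S R) u =
      word_value (presented_group S R) (presented_gen S R) v"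
  shows "word_value T f u = word_value T f v"
proof -
  let ?F = "free_group S" and ?N = "normal_closure (free_group S) (relators S R)"
  interpret T: group T by fact
  interpret F: group ?F by (rule group_free_group)
  interpret N: normal ?N ?F by (rule normal_closure_relators_normal)
  obtain h where h: "h \<in> hom ?F T"
    and val: "\<And>w. w \<in> words S \<Longrightarrow> h (free_rel S `` {w}) = word_value T f w"
    using free_group_extend[OF assms(1) f] by blast
  interpret h: group_hom ?F T h using h by unfold_locales
  have cl: "free_rel S `` {w} \<in> carrier ?F" if "w \<in> words S" for w
    using that by (auto simp: carrier_free_group)
  have quot: "h (free_rel S `` {l} \<otimes>\<^bsub>?F\<^esub> inv\<^bsub>?F\<^esub> (free_rel S `` {r})) =
      word_value T f l \<otimes>\<^bsub>T\<^esub> inv\<^bsub>T\<^esub> word_value T f r" if "l \<in> words S" "r \<in> words S" for l r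
    using that cl by (simp add: val)
  have "relators S R \<subseteq> kernel ?F T h"
  proof
    fix g assume "g \<in> relators S R"
    then obtain l r where lr: "(l, r) \<in> R"
      and g: "g = free_rel S `` {l} \<otimes>\<^bsub>?F\<^esub> inv\<^bsub>?F\<^esub> (free_rel S `` {r})"
      by (auto simp: relators_def)
    show "g \<in> kernel ?F T h"
      using relation_words[OF lr] rel[OF lr] T.word_value_closed[OF f] quot[of l r] cl
      by (simp add: kernel_def g)
  qed
  then have ker: "?N \<subseteq> kernel ?F T h"
    using h.normal_kernel by (auto simp: normal_closure_def)
  have "free_rel S `` {u} \<in> ?N #>\<^bsub>?F\<^esub> (free_rel S `` {v})"
    using eq w cl F.rcos_self[OF _ N.subgroup_axioms] by (simp add: word_value_presented_gen) blast
  then have "free_rel S `` {u} \<otimes>\<^bsub>?F\<^esub> inv\<^bsub>?F\<^esub> (free_rel S `` {v}) \<in> ?N"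
    using cl w N.rcos_module_imp[OF F.is_group] by simp
  then have "word_value T f u \<otimes>\<^bsub>T\<^esub> inv\<^bsub>T\<^esub> word_value T f v = \<one>\<^bsub>T\<^esub>"
    using ker quot[OF w] by (auto simp: kernel_def)
  then show ?thesis
    using T.inv_equality[of "word_value T f u" "inv\<^bsub>T\<^esub> word_value T f v"] T.word_value_closed[OF f] w
    by simp
qed

end

section \<open>Geometric sums of an endomorphism\<close>

text \<open>
  In an abelian group, written additively, this is \<open>(1 + s + s\<^sup>2 + \<dots> + s\<^bsup>n - 1\<^esup>) x\<close>.
  The definition makes sense in any group and is used there as well, since this recursion is the
  one satisfied by the two sides of an alternating relation.
\<close>

primrec geom_sum :: "('g, 'm) monoid_scheme \<Rightarrow> ('g \<Rightarrow> 'g) \<Rightarrow> nat \<Rightarrow> 'g \<Rightarrow> 'g"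
  where
    "geom_sum G s 0 x = \<one>\<^bsub>G\<^esub>"
  | "geom_sum G s (Suc n) x = x \<otimes>\<^bsub>G\<^esub> s (geom_sum G s n x)"

context comm_group
begin

context
  fixes s :: "'a \<Rightarrow> 'a"
  assumes s: "s \<in> hom G G"
begin

interpretation s: group_hom G G s
  using s by unfold_locales

lemma geom_sum_closed: "x \<in> carrier G \<Longrightarrow> geom_sum G s n x \<in> carrier G"
  by (induction n) auto

lemma geom_sum_mult:
  "x \<in> carrier G \<Longrightarrow> y \<in> carrier G \<Longrightarrow>
    geom_sum G s n (x \<otimes> y) = geom_sum G s n x \<otimes> geom_sum G s n y"
  by (induction n) (auto simp: geom_sum_closed m_ac)

lemma geom_sum_one: "geom_sum G s n \<one> = \<one>"
  by (induction n) auto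

lemma geom_sum_add:
  "x \<in> carrier G \<Longrightarrow> geom_sum G s (m + n) x = geom_sum G s m x \<otimes> (s ^^ m) (geom_sum G s n x)"
proof (induction m)
  case (Suc m)
  have "(s ^^ k) y \<in> carrier G" if "y \<in> carrier G" for k y
    using that by (induction k) auto
  with Suc show ?case by (simp add: geom_sum_closed m_assoc)
qed (simp add: geom_sum_closed)

lemma geom_sum_endo: "x \<in> carrier G \<Longrightarrow> s (geom_sum G s n x) = geom_sum G s n (s x)"
  by (induction n) (auto simp: geom_sum_closed)

lemma geom_sum_commute:
  "x \<in> carrier G \<Longrightarrow> geom_sum G s m (geom_sum G s n x) = geom_sum G s n (geom_sum G s m x)"
  by (induction m) (auto simp: geom_sum_closed geom_sum_mult geom_sum_endo geom_sum_one)

lemma geom_sum_mult_index: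
  assumes "x \<in> carrier G" "geom_sum G s m x = \<one>"
  shows "geom_sum G s (k * m) x = \<one>"
proof (induction k)
  case (Suc k)
  have "(s ^^ j) \<one> = \<one>" for j by (induction j) auto
  with Suc show ?case using assms by (simp add: geom_sum_add)
qed simp

text \<open>
  The indices at which the geometric sum of \<open>x\<close> vanishes are closed under multiples, and by
  \<open>geom_sum_add\<close> also under subtraction of a smaller vanishing index. A Bezout identity
  therefore brings two coprime vanishing indices down to the index \<open>1\<close>, whose sum is \<open>x\<close>.
\<close>

lemma geom_sum_coprime:
  assumes x: "x \<in> carrier G" and "coprime m n"
    and m: "geom_sum G s m x = \<one>" and n: "geom_sum G s n x = \<one>"
  shows "x = \<one>"
proof (cases "m = 0")
  case True
  with assms have "n = 1" by simp
  with n x show ?thesis by simp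
next
  case False
  then obtain k l where "m * k = n * l + 1"
    using \<open>coprime m n\<close> bezout_nat[of m n] by auto
  then have "geom_sum G s (1 + l * n) x = \<one>"
    using geom_sum_mult_index[OF x m, of k] by (simp add: mult.commute)
  then show ?thesis
    using geom_sum_mult_index[OF x n, of l] x by (simp del: mult_Suc)
qed

text \<open>
  Write \<open>D k\<close> for the \<open>k\<close>-th geometric sum. The element \<open>D n x\<close> is killed by \<open>D m\<close>, as \<open>x\<close>
  is, and by \<open>D p\<close>, because \<open>D n\<close> does not see the difference between \<open>x\<close> and \<open>x \<otimes> y\<close>.
  Coprimality of \<open>m\<close> and \<open>p\<close> gives \<open>D n x = \<one>\<close>, and then coprimality of \<open>m\<close> and \<open>n\<close> gives
  \<open>x = \<one>\<close>. The roles of \<open>x\<close> and \<open>y\<close> are symmetric.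
\<close>

lemma geom_sum_three:
  assumes xy: "x \<in> carrier G" "y \<in> carrier G"
    and cop: "coprime m n" "coprime n p" "coprime m p"
    and m: "geom_sum G s m x = \<one>" and n: "geom_sum G s n y = \<one>"
    and p: "geom_sum G s p (x \<otimes> y) = \<one>"
  shows "x = \<one> \<and> y = \<one>"
proof -
  let ?D = "geom_sum G s"
  have main: "u = \<one>" if uv: "u \<in> carrier G" "v \<in> carrier G" and c: "coprime i j" "coprime i p"
    and i: "?D i u = \<one>" and j: "?D j v = \<one>" and p: "?D p (u \<otimes> v) = \<one>" for u v i j
  proof -
    have "?D p (?D j u) = ?D p (?D j (u \<otimes> v))"
      using uv j by (simp add: geom_sum_mult geom_sum_closed)
    also have "\<dots> = ?D j (?D p (u \<otimes> v))"
      using uv by (simp add: geom_sum_commute)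
    finally have "?D p (?D j u) = \<one>" using p by (simp add: geom_sum_one)
    moreover have "?D i (?D j u) = \<one>"
      using uv i by (simp add: geom_sum_commute[of u i j] geom_sum_one)
    ultimately have "?D j u = \<one>"
      using geom_sum_coprime[OF geom_sum_closed[OF uv(1)] c(2)] by blast
    with geom_sum_coprime[OF uv(1) c(1) i] show ?thesis by blast
  qed
  show ?thesis
    using main[of x y m n] main[of y x n m] assms by (simp add: m_comm coprime_commute)
qed

end

end

section \<open>Alternating relations in metabelian groups\<close>

context group
begin

abbreviation inv_conj :: "'a \<Rightarrow> 'a \<Rightarrow> 'a"
  where "inv_conj t g \<equiv> inv (t \<otimes> g \<otimes> inv t)"

lemma word_value_alternating_closed:
  assumes "f x \<in> carrier G" "f y \<in> carrier G"
  shows "word_value G f (alternating x y n) \<in> carrier G"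
  using assms by (intro word_value_closed[where S = "{x, y}"] alternating_words) auto

text \<open>
  If \<open>U\<close> and \<open>V\<close> are the values of the alternating words of length \<open>n\<close> beginning with \<open>x\<close> and
  \<open>y\<close>, then those of length \<open>n + 1\<close> are \<open>f x \<otimes> V\<close> and \<open>f y \<otimes> U\<close>. Their quotient is
  \<open>(f y \<otimes> inv (f x)) \<otimes> f x \<otimes> inv (V \<otimes> inv U) \<otimes> inv (f x)\<close>, which is the recursion of
  \<open>geom_sum\<close> for the map that conjugates by \<open>f x\<close> and inverts.
\<close>

lemma alternating_quotient:
  assumes "f x \<in> carrier G" "f y \<in> carrier G"
  shows "word_value G f (alternating y x n) \<otimes> inv (word_value G f (alternating x y n)) =
    geom_sum G (inv_conj (f x)) n (f y \<otimes> inv (f x))"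
proof (induction n)
  case (Suc n)
  let ?U = "word_value G f (alternating x y n)" and ?V = "word_value G f (alternating y x n)"
  have UV: "?U \<in> carrier G" "?V \<in> carrier G"
    using assms by (simp_all add: word_value_alternating_closed)
  have "word_value G f (alternating y x (Suc n)) \<otimes> inv (word_value G f (alternating x y (Suc n)))
      = f y \<otimes> ?U \<otimes> inv (f x \<otimes> ?V)"
    by simp
  also have "\<dots> = f y \<otimes> inv (f x) \<otimes> inv_conj (f x) (?V \<otimes> inv ?U)"
  proof -
    have "inv (f x) \<otimes> (f x \<otimes> z) = z" if "z \<in> carrier G" for z
      using that assms by (simp add: m_assoc[symmetric])
    then show ?thesis using assms UV by (simp add: inv_mult_group m_assoc)
  qed
  finally show ?case by (simp add: Suc)
qed (use assms in simp)

lemma alternating_relation_geom_sum: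
  assumes "f x \<in> carrier G" "f y \<in> carrier G"
    and "word_value G f (alternating x y n) = word_value G f (alternating y x n)"
  shows "geom_sum G (inv_conj (f x)) n (f y \<otimes> inv (f x)) = \<one>"
  using alternating_quotient[of f x y n] assms word_value_alternating_closed[of f y x n] by simp

lemma geom_sum_subgroup_cong:
  assumes "subgroup A G" "x \<in> A" "\<And>g. g \<in> A \<Longrightarrow> s g \<in> A" "\<And>g. g \<in> A \<Longrightarrow> s' g = s g"
  shows "geom_sum (G\<lparr>carrier := A\<rparr>) s n x = geom_sum G s' n x"
proof -
  have "geom_sum G s n x \<in> A \<and> geom_sum (G\<lparr>carrier := A\<rparr>) s n x = geom_sum G s' n x \<and>
      geom_sum G s n x = geom_sum G s' n x"
  proof (induction n)
    case 0
    show ?case using subgroup.one_closed[OF assms(1)] by simp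
  next
    case (Suc n)
    then have "s (geom_sum G s n x) \<in> A" "s' (geom_sum G s n x) = s (geom_sum G s n x)"
      using assms(3,4) by blast+
    with Suc show ?case using subgroup.m_closed[OF assms(1,2)] by simp
  qed
  then show ?thesis by simp
qed

text \<open>
  The three generators act in the same way on \<open>A\<close>, since they differ by elements of the abelian
  group \<open>A\<close>, so the three relations become vanishing geometric sums for a single endomorphism of
  \<open>A\<close>: of length \<open>M\<close> at \<open>d = f y \<otimes> inv (f x)\<close>, of length \<open>N\<close> at \<open>e = f z \<otimes> inv (f y)\<close>, and of
  length \<open>P\<close> at \<open>d \<otimes> e = f z \<otimes> inv (f x)\<close>.
\<close>

lemma triangle_relations_metabelian:
  assumes A: "A \<lhd> G" and comm: "\<And>g h. g \<in> A \<Longrightarrow> h \<in> A \<Longrightarrow> g \<otimes> h = h \<otimes> g"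
    and f: "f x \<in> carrier G" "f y \<in> carrier G" "f z \<in> carrier G"
    and yx: "f y \<otimes> inv (f x) \<in> A" and zy: "f z \<otimes> inv (f y) \<in> A"
    and M: "word_value G f (alternating x y M) = word_value G f (alternating y x M)"
    and N: "word_value G f (alternating y z N) = word_value G f (alternating z y N)"
    and P: "word_value G f (alternating z x P) = word_value G f (alternating x z P)"
    and cop: "coprime M N" "coprime N P" "coprime M P"
  shows "f x = f y \<and> f y = f z"
proof -
  interpret A: normal A G by fact
  let ?B = "G\<lparr>carrier := A\<rparr>"
  have "group ?B" by (rule A.subgroup_is_group[OF group_axioms])
  then interpret B: comm_group ?B
    by (rule group.group_comm_groupI) (simp add: comm)
  let ?s = "inv_conj (f x)"
  have Ac: "g \<in> carrier G" if "g \<in> A" for g using that A.subset by blast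
  have s_closed: "?s g \<in> A" if "g \<in> A" for g
    using that f by (simp add: A.inv_op_closed2)
  have "?s \<in> hom ?B ?B"
  proof (rule homI)
    fix g h assume "g \<in> carrier ?B" "h \<in> carrier ?B"
    then have gh: "g \<in> A" "h \<in> A" by auto
    have "inv (f x) \<otimes> (f x \<otimes> z) = z" if "z \<in> carrier G" for z
      using that f by (simp add: m_assoc[symmetric])
    then have "?s (h \<otimes> g) = ?s g \<otimes> ?s h"
      using gh Ac f by (simp add: inv_mult_group m_assoc)
    then show "?s (g \<otimes>\<^bsub>?B\<^esub> h) = ?s g \<otimes>\<^bsub>?B\<^esub> ?s h"
      using comm[OF gh] by simp
  qed (use s_closed in simp)
  have same_action: "inv_conj (f y) g = ?s g" if g: "g \<in> A" for g
  proof -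
    let ?d = "f y \<otimes> inv (f x)" and ?k = "f x \<otimes> g \<otimes> inv (f x)"
    have k: "?k \<in> A" using g f by (simp add: A.inv_op_closed2)
    have "inv (f x) \<otimes> (f x \<otimes> z) = z" if "z \<in> carrier G" for z
      using that f by (simp add: m_assoc[symmetric])
    then have "f y \<otimes> g \<otimes> inv (f y) = ?d \<otimes> ?k \<otimes> inv ?d"
      using g Ac f by (simp add: inv_mult_group m_assoc)
    also have "\<dots> = ?k \<otimes> ?d \<otimes> inv ?d" by (simp only: comm[OF yx k])
    also have "\<dots> = ?k" using Ac[OF k] Ac[OF yx] by (simp only: m_assoc r_inv inv_closed r_one)
    finally show ?thesis by simp
  qed
  let ?d = "f y \<otimes> inv (f x)" and ?e = "f z \<otimes> inv (f y)"
  have transfer: "geom_sum ?B ?s n g = geom_sum G s' n g"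
    if "g \<in> A" "\<And>h. h \<in> A \<Longrightarrow> s' h = ?s h" for g n s'
    by (rule geom_sum_subgroup_cong[OF A.subgroup_axioms that(1) s_closed that(2)])
  have "geom_sum ?B ?s M ?d = \<one>\<^bsub>?B\<^esub>"
    using transfer[OF yx, of ?s M] alternating_relation_geom_sum[OF f(1,2) M] by simp
  moreover have "geom_sum ?B ?s N ?e = \<one>\<^bsub>?B\<^esub>"
    using transfer[OF zy same_action, of N] alternating_relation_geom_sum[OF f(2,3) N] by simp
  moreover have "geom_sum ?B ?s P (?d \<otimes>\<^bsub>?B\<^esub> ?e) = \<one>\<^bsub>?B\<^esub>"
  proof -
    have "?e \<otimes> ?d = f z \<otimes> inv (f x)"
      using f by (simp add: m_assoc) (simp add: m_assoc[symmetric])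
    then have zx: "?d \<otimes> ?e = f z \<otimes> inv (f x)" using comm[OF yx zy] by simp
    then have "f z \<otimes> inv (f x) \<in> A" using A.m_closed[OF yx zy] by simp
    then show ?thesis
      using transfer[of "f z \<otimes> inv (f x)" ?s P] zx
        alternating_relation_geom_sum[OF f(1,3) P[symmetric]] by simp
  qed
  ultimately have "?d = \<one> \<and> ?e = \<one>"
    using B.geom_sum_three[OF \<open>?s \<in> hom ?B ?B\<close> _ _ cop] yx zy by simp
  then show ?thesis
    using f inv_equality[of "f y" "inv (f x)"] inv_equality[of "f z" "inv (f y)"] by simp
qed

text \<open>
  In the quotient by \<open>derived G B\<close> the image of \<open>B\<close> is abelian, so the generators become equal
  there. This pushes the differences of the generators one step down the derived series, and can
  be applied repeatedly: starting from \<open>B = carrier G\<close>, where there is nothing to check, it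
  reaches first \<open>derived G (carrier G)\<close> and then its own derived subgroup.
\<close>

lemma triangle_relations_derived:
  assumes B: "B \<lhd> G"
    and f: "f x \<in> carrier G" "f y \<in> carrier G" "f z \<in> carrier G"
    and yx: "f y \<otimes> inv (f x) \<in> B" and zy: "f z \<otimes> inv (f y) \<in> B"
    and M: "word_value G f (alternating x y M) = word_value G f (alternating y x M)"
    and N: "word_value G f (alternating y z N) = word_value G f (alternating z y N)"
    and P: "word_value G f (alternating z x P) = word_value G f (alternating x z P)"
    and cop: "coprime M N" "coprime N P" "coprime M P"
  shows "f y \<otimes> inv (f x) \<in> derived G B \<and> f z \<otimes> inv (f y) \<in> derived G B"
proof -
  let ?K = "derived G B"
  interpret B: normal B G by fact
  interpret K: normal ?K G by (rule derived_is_normal[OF B])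
  let ?Q = "G Mod ?K" and ?p = "\<lambda>g. ?K #> g"
  interpret Q: group ?Q by (rule K.factorgroup_is_group)
  interpret p: group_hom G ?Q ?p
    using K.r_coset_hom_Mod by unfold_locales
  have Bc: "g \<in> carrier G" if "g \<in> B" for g using that B.subset by blast
  have p_eq: "g \<otimes> inv h \<in> ?K" if "?p g = ?p h" "g \<in> carrier G" "h \<in> carrier G" for g h
    using that rcos_self[OF that(2) K.subgroup_axioms] K.rcos_module_imp[OF group_axioms that(3)] by simp
  have "?p ` B \<lhd> ?Q"
  proof (rule Q.normal_invI)
    show "subgroup (?p ` B) ?Q" by (rule p.subgroup_img_is_subgroup[OF B.subgroup_axioms])
    fix q h assume "q \<in> carrier ?Q" "h \<in> ?p ` B"
    then obtain g b where g: "g \<in> carrier G" "q = ?p g" and b: "b \<in> B" "h = ?p b"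
      by (auto simp: carrier_FactGroup)
    have "q \<otimes>\<^bsub>?Q\<^esub> h \<otimes>\<^bsub>?Q\<^esub> inv\<^bsub>?Q\<^esub> q = ?p (g \<otimes> b \<otimes> inv g)"
      using g b Bc by (simp only: p.hom_mult p.hom_inv m_closed inv_closed)
    then show "q \<otimes>\<^bsub>?Q\<^esub> h \<otimes>\<^bsub>?Q\<^esub> inv\<^bsub>?Q\<^esub> q \<in> ?p ` B"
      using g b B.inv_op_closed2 by blast
  qed
  moreover have "u \<otimes>\<^bsub>?Q\<^esub> v = v \<otimes>\<^bsub>?Q\<^esub> u" if uv: "u \<in> ?p ` B" "v \<in> ?p ` B" for u v
  proof -
    obtain g h where gh: "g \<in> B" "u = ?p g" "h \<in> B" "v = ?p h" using uv by blast
    have "g \<otimes> h \<otimes> inv g \<otimes> inv h \<in> ?K"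
      unfolding derived_def using gh by (intro generate.incl) auto
    moreover have "g \<otimes> h = (g \<otimes> h \<otimes> inv g \<otimes> inv h) \<otimes> (h \<otimes> g)"
    proof -
      have "inv k \<otimes> (k \<otimes> z) = z" if "k \<in> carrier G" "z \<in> carrier G" for k z
        using that by (simp add: m_assoc[symmetric])
      then show ?thesis using gh Bc by (simp add: m_assoc)
    qed
    ultimately have "g \<otimes> h \<in> ?K #> (h \<otimes> g)" unfolding r_coset_def by blast
    then have "?p (h \<otimes> g) = ?p (g \<otimes> h)"
      using gh Bc by (intro repr_independence K.subgroup_axioms) auto
    then show ?thesis using gh Bc by (simp only: p.hom_mult)
  qed
  moreover have "word_value ?Q (\<lambda>x. ?p (f x)) (alternating u v n) = ?p (word_value G f (alternating u v n))"
    if "f u \<in> carrier G" "f v \<in> carrier G" for u v n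
    using that by (intro p.hom_word_value[where S = "{u, v}", symmetric] alternating_words) auto
  moreover have "?p (f y) \<otimes>\<^bsub>?Q\<^esub> inv\<^bsub>?Q\<^esub> ?p (f x) \<in> ?p ` B"
    "?p (f z) \<otimes>\<^bsub>?Q\<^esub> inv\<^bsub>?Q\<^esub> ?p (f y) \<in> ?p ` B"
    using f yx zy by (simp_all only: p.hom_mult[symmetric] p.hom_inv[symmetric] inv_closed imageI)
  ultimately have "?p (f x) = ?p (f y) \<and> ?p (f y) = ?p (f z)"
    using f M N P cop
    by (intro Q.triangle_relations_metabelian[of "?p ` B" "\<lambda>x. ?p (f x)" x y z M N P]) (auto intro: p.hom_closed)
  then show ?thesis using f p_eq by simp
qed

text \<open>
  If all generators lie in one coset of \<open>K\<close>, then the quotient by \<open>K\<close> is cyclic.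
\<close>

lemma word_value_modulo_normal:
  assumes K: "K \<lhd> G" and f: "f \<in> S \<rightarrow> carrier G" and t: "t \<in> carrier G"
    and ft: "\<And>x. x \<in> S \<Longrightarrow> f x \<otimes> inv t \<in> K" and w: "w \<in> words S"
  shows "\<exists>i :: int. word_value G f w \<in> K #> (t [^] i)"
  using w
proof (induction w)
  case Nil
  interpret K: normal K G by fact
  have "\<one> \<in> K #> (t [^] (0::int))"
    using K.subset by simp
  then show ?case by (metis word_value.simps(1))
next
  case (Cons l w)
  interpret K: normal K G by fact
  obtain i :: int where i: "word_value G f w \<in> K #> (t [^] i)" using Cons by auto
  let ?g = "f (fst l)"
  have g: "?g \<in> carrier G" using Cons.prems f by auto
  have "?g \<in> K #> t"
    using ft[of "fst l"] Cons.prems g t by (simp add: K.rcos_module_rev[OF group_axioms])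
  then have gt: "K #> ?g = K #> t"
    using t K.subgroup_axioms by (metis repr_independence)
  define e :: int where "e = (if snd l then 1 else -1)"
  have "K #> (if snd l then ?g else inv ?g) = K #> (t [^] e)"
    using gt g t by (auto simp: e_def int_pow_neg K.rcos_inv[symmetric])
  moreover have "K #> word_value G f w = K #> (t [^] i)"
    using i t K.subgroup_axioms by (metis int_pow_closed repr_independence)
  moreover have wc: "word_value G f w \<in> carrier G" 
    using Cons.prems f by (auto intro: word_value_closed)
  ultimately have "K #> word_value G f (l # w) = K #> (t [^] (e + i))"
    using g t by (simp add: K.rcos_sum[symmetric] int_pow_mult)
  then have "word_value G f (l # w) \<in> K #> (t [^] (e + i))"
    using rcos_self[OF _ K.subgroup_axioms, of "word_value G f (l # w)"] g wc by auto
  then show ?case ..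
qed

lemma derived_subset_if_cyclic_quotient:
  assumes K: "K \<lhd> G" and t: "t \<in> carrier G"
    and cyc: "\<And>g. g \<in> carrier G \<Longrightarrow> \<exists>i :: int. g \<in> K #> (t [^] i)"
  shows "derived G (carrier G) \<subseteq> K"
proof (rule derived_minimal[OF K])
  interpret K: normal K G by fact
  show "comm_group (G Mod K)"
  proof (rule group.group_comm_groupI[OF K.factorgroup_is_group])
    have pow: "\<exists>i :: int. q = K #> (t [^] i)" if "q \<in> carrier (G Mod K)" for q
      using that cyc t K.subgroup_axioms
      by (force simp: carrier_FactGroup dest: repr_independence)
    fix p q assume "p \<in> carrier (G Mod K)" "q \<in> carrier (G Mod K)"
    then obtain i j :: int where "p = K #> (t [^] i)" "q = K #> (t [^] j)" using pow by blast
    then show "p \<otimes>\<^bsub>G Mod K\<^esub> q = q \<otimes>\<^bsub>G Mod K\<^esub> p"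
      using t by (simp add: K.rcos_sum int_pow_mult[symmetric] add.commute)
  qed
qed

end

section \<open>Free quotients and perfect subgroups\<close>

lemma free_group_exponent_sum:
  obtains h where "h \<in> hom (free_group S) integer_group"
    and "\<And>y. y \<in> S \<Longrightarrow> h (free_gen S y) = (if y = x then 1 else 0)"
proof -
  let ?f = "\<lambda>y. if y = x then 1 else 0 :: int"
  obtain h where "h \<in> hom (free_group S) integer_group"
    and "\<And>w. w \<in> words S \<Longrightarrow> h (free_rel S `` {w}) = word_value integer_group ?f w"
    using free_group_extend[OF group_integer_group, of ?f S] by auto
  then show thesis by (intro that) (auto simp: free_gen_def)
qed

text \<open>
  The hypothesis says that there is at most one free generator; the empty basis is included.
\<close>

lemma derived_free_group_rank_one:
  assumes "\<And>x. x \<in> S \<Longrightarrow> x = b"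
  shows "derived (free_group S) (carrier (free_group S)) \<subseteq> {\<one>\<^bsub>free_group S\<^esub>}"
proof -
  interpret F: group "free_group S" by (rule group_free_group)
  define t where "t = (if b \<in> S then free_gen S b else \<one>\<^bsub>free_group S\<^esub>)"
  have t: "t \<in> carrier (free_group S)" using free_gen_closed[of S] by (auto simp: t_def)
  have gen: "free_gen S x \<otimes>\<^bsub>free_group S\<^esub> inv\<^bsub>free_group S\<^esub> t \<in> {\<one>\<^bsub>free_group S\<^esub>}" if "x \<in> S" for x
    using that assms[OF that] free_gen_closed[of S] by (auto simp: t_def Pi_iff)
  have "\<exists>i :: int. g \<in> {\<one>\<^bsub>free_group S\<^esub>} #>\<^bsub>free_group S\<^esub> (t [^]\<^bsub>free_group S\<^esub> i)"
    if "g \<in> carrier (free_group S)" for g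
  proof -
    from that obtain w where w: "w \<in> words S" "g = free_rel S `` {w}"
      by (auto simp: carrier_free_group)
    show ?thesis
      using F.word_value_modulo_normal[OF F.one_is_normal free_gen_closed t gen w(1)] w
      by (simp add: word_value_free_gen)
  qed
  with F.derived_subset_if_cyclic_quotient[OF F.one_is_normal t] show ?thesis by blast
qed

lemma int_pow_integer_group: "x [^]\<^bsub>integer_group\<^esub> (n :: int) = n * x"
proof -
  interpret Z: group integer_group by simp
  have nat: "x [^]\<^bsub>integer_group\<^esub> (k :: nat) = int k * x" for k
    by (induction k) (auto simp: algebra_simps)
  show ?thesis
    by (cases n rule: int_cases2) (auto simp: Z.int_pow_neg_int int_pow_int nat)
qed

lemma (in group_hom) hom_perfect_abelian:
  assumes "K \<subseteq> carrier G" "derived G K = K" "derived H (carrier H) \<subseteq> {\<one>\<^bsub>H\<^esub>}" and "k \<in> K"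
  shows "h k = \<one>\<^bsub>H\<^esub>"
proof -
  have "h ` K = derived H (h ` K)" using derived_img[OF assms(1)] assms(2) by simp
  also have "\<dots> \<subseteq> derived H (carrier H)" using assms(1) by (intro H.mono_derived) auto
  finally show ?thesis using assms(3,4) by blast
qed

context group
begin

text \<open>
  Every homomorphism from \<open>L\<close> to an abelian group kills the perfect subgroup \<open>K\<close>. If a basis of the
  free quotient by \<open>A\<close> has two distinct elements \<open>x\<close> and \<open>y\<close>, then their exponent sums give two
  linearly independent homomorphisms from \<open>L\<close> to the integers, which both factor through \<open>L / K\<close>;
  but \<open>L / K\<close> is cyclic, a contradiction. So the basis has at most one element, the free group is
  abelian, and the image of \<open>K\<close> in it is trivial.

  The subgroup \<open>L / K\<close> of the cyclic group \<open>G / K\<close> is used through the exponents of its elements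
  as powers of the class of \<open>t\<close>, although \<open>t\<close> itself need not lie in \<open>L\<close>.
\<close>

lemma perfect_subset_free_quotient:
  assumes K: "K \<lhd> G" and perfect: "derived G K = K" and t: "t \<in> carrier G"
    and cyc: "\<And>g. g \<in> carrier G \<Longrightarrow> \<exists>i :: int. g \<in> K #> (t [^] i)"
    and L: "subgroup L G" "K \<subseteq> L"
    and A: "A \<lhd> G\<lparr>carrier := L\<rparr>" and free: "is_free_group (G\<lparr>carrier := L\<rparr> Mod A)"
  shows "K \<subseteq> A"
proof -
  let ?L = "G\<lparr>carrier := L\<rparr>"
  let ?Q = "?L Mod A"
  interpret K: normal K G by fact
  interpret L: group ?L using L(1) by (rule subgroup_imp_group)
  interpret A: normal A ?L by fact
  interpret Q: group ?Q by (rule A.factorgroup_is_group)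
  obtain S :: "'a set set" and \<phi> where \<phi>: "\<phi> \<in> iso (free_group S) ?Q"
    using free unfolding is_free_group_def is_iso_def by blast
  let ?F = "free_group S"
  interpret F: group ?F by (rule group_free_group)
  define \<psi> where "\<psi> = inv_into (carrier ?F) \<phi>"
  have \<psi>: "\<psi> \<in> iso ?Q ?F" unfolding \<psi>_def using \<phi> by (rule F.iso_set_sym)
  define q where "q g = \<psi> (A #>\<^bsub>?L\<^esub> g)" for g
  have "q \<in> hom ?L ?F"
    using Group.hom_compose[OF A.r_coset_hom_Mod, of \<psi> ?F] \<psi> by (simp add: q_def[abs_def] o_def iso_def)
  then interpret q: group_hom ?L ?F q by unfold_locales
  have surj: "\<exists>g \<in> L. q g = u" if "u \<in> carrier ?F" for u
  proof -
    have "u \<in> \<psi> ` carrier ?Q" using \<psi> that by (simp add: iso_def bij_betw_def)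
    then show ?thesis by (auto simp: carrier_FactGroup q_def)
  qed
  have perfect_L: "derived ?L K = K" using derived_consistent[OF L(2,1)] perfect by simp
  have K_L: "K \<subseteq> carrier ?L" using L(2) by simp
  show ?thesis
  proof (cases "\<exists>x\<in>S. \<exists>y\<in>S. x \<noteq> y")
    case True
    then obtain x y where xy: "x \<in> S" "y \<in> S" "x \<noteq> y" by blast
    obtain \<alpha> where \<alpha>: "\<alpha> \<in> hom ?F integer_group"
      "\<And>z. z \<in> S \<Longrightarrow> \<alpha> (free_gen S z) = (if z = x then 1 else 0)"
      using free_group_exponent_sum[where x = x and S = S] by blast
    obtain \<beta> where \<beta>: "\<beta> \<in> hom ?F integer_group"
      "\<And>z. z \<in> S \<Longrightarrow> \<beta> (free_gen S z) = (if z = y then 1 else 0)"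
      using free_group_exponent_sum[where x = y and S = S] by blast
    obtain g where g: "g \<in> L" "q g = free_gen S x" using surj free_gen_closed[of S] xy by blast
    obtain h where h: "h \<in> L" "q h = free_gen S y" using surj free_gen_closed[of S] xy by blast
    have gh: "g \<in> carrier G" "h \<in> carrier G" using g h L(1) subgroup.subset by blast+
    obtain i j :: int where i: "g \<in> K #> (t [^] i)" and j: "h \<in> K #> (t [^] j)"
      using cyc gh by blast
    interpret Z: comm_group integer_group by (rule abelian_integer_group)
    have Z: "derived integer_group (carrier integer_group) \<subseteq> {\<one>\<^bsub>integer_group\<^esub>}"
      using Z.derived_eq_singleton[of "carrier integer_group"] by simp
    have i': "K #> g = K #> (t [^] i)" and j': "K #> h = K #> (t [^] j)"
      using i j t K.subgroup_axioms by (metis int_pow_closed repr_independence)+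
    have "K #> (g [^] j) = K #> (h [^] i)"
    proof -
      have "K #> (g [^] j) = K #> ((t [^] i) [^] j)"
        using i' gh t K.FactGroup_int_pow by (metis int_pow_closed)
      also have "\<dots> = K #> ((t [^] j) [^] i)" using t by (simp add: int_pow_pow mult.commute)
      also have "\<dots> = K #> (h [^] i)"
        using j' gh t K.FactGroup_int_pow by (metis int_pow_closed)
      finally show ?thesis .
    qed
    then have rel: "g [^] j \<otimes> inv (h [^] i) \<in> K"
      using rcos_self[OF _ K.subgroup_axioms, of "g [^] j"] gh
        K.rcos_module_imp[OF group_axioms, of "h [^] i" "g [^] j"] by simp
    \<comment> \<open>A homomorphism to the integers cannot separate \<open>g [^] j\<close> from \<open>h [^] i\<close>, which agree modulo \<open>K\<close>.\<close>
    have proportional: "j * \<gamma> (q g) = i * \<gamma> (q h)" "g \<in> K \<Longrightarrow> \<gamma> (q g) = 0"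
      if \<gamma>: "\<gamma> \<in> hom ?F integer_group" for \<gamma>
    proof -
      have "\<gamma> \<circ> q \<in> hom ?L integer_group"
        using Group.hom_compose[OF \<open>q \<in> hom ?L ?F\<close> \<gamma>] .
      then interpret \<gamma>: group_hom ?L integer_group "\<gamma> \<circ> q" by unfold_locales
      have kill: "\<gamma> (q k) = 0" if "k \<in> K" for k
        using \<gamma>.hom_perfect_abelian[OF K_L perfect_L Z that] by simp
      show "g \<in> K \<Longrightarrow> \<gamma> (q g) = 0" by (rule kill)
      have pow: "\<gamma> (q (k [^] n)) = n * \<gamma> (q k)" if "k \<in> L" for k and n :: int
        using \<gamma>.hom_int_pow[of k n] that int_pow_consistent[OF L(1) that, of n]
        by (simp add: int_pow_integer_group)
      have L_pow: "k [^] n \<in> L" if "k \<in> L" for k and n :: int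
        using L.int_pow_closed[of k n] int_pow_consistent[OF L(1) that, of n] that by simp
      have "g [^] j \<otimes> inv (h [^] i) = g [^] j \<otimes>\<^bsub>?L\<^esub> inv\<^bsub>?L\<^esub> (h [^] i)"
        using L_pow[OF h(1)] L(1) by (simp add: m_inv_consistent)
      then have "(\<gamma> \<circ> q) (g [^] j \<otimes>\<^bsub>?L\<^esub> inv\<^bsub>?L\<^esub> (h [^] i)) = 0"
        using kill[OF rel] by simp
      moreover have "g [^] j \<in> carrier ?L" "h [^] i \<in> carrier ?L"
        using L_pow[OF g(1), of j] L_pow[OF h(1), of i] by simp_all
      ultimately have "(\<gamma> \<circ> q) (g [^] j) \<otimes>\<^bsub>integer_group\<^esub> inv\<^bsub>integer_group\<^esub> (\<gamma> \<circ> q) (h [^] i) = 0"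
        by (simp only: \<gamma>.hom_mult \<gamma>.hom_inv L.inv_closed)
      then show "j * \<gamma> (q g) = i * \<gamma> (q h)"
        using pow g(1) h(1) by simp
    qed
    have "j = 0" using proportional(1)[OF \<alpha>(1)] \<alpha>(2) xy g(2) h(2) by simp
    moreover have "i = 0" using proportional(1)[OF \<beta>(1)] \<beta>(2) xy g(2) h(2) by simp
    ultimately have "g \<in> K" using i K.subset by simp
    then show ?thesis using proportional(2)[OF \<alpha>(1)] \<alpha>(2) xy g(2) by simp
  next
    case False
    then obtain b where "\<And>x. x \<in> S \<Longrightarrow> x = b" by blast
    then have abelian: "derived ?F (carrier ?F) \<subseteq> {\<one>\<^bsub>?F\<^esub>}"
      by (rule derived_free_group_rank_one)
    show ?thesis
    proof
      fix k assume k: "k \<in> K"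
      interpret \<psi>: group_hom ?Q ?F \<psi>
        using \<psi> by unfold_locales (simp add: iso_def)
      have kL: "k \<in> carrier ?L" using k L(2) by auto
      then have kQ: "A #>\<^bsub>?L\<^esub> k \<in> carrier ?Q" by (auto simp: carrier_FactGroup)
      have "\<psi> (A #>\<^bsub>?L\<^esub> k) = \<psi> \<one>\<^bsub>?Q\<^esub>"
        using q.hom_perfect_abelian[OF K_L perfect_L abelian k] by (simp only: q_def \<psi>.hom_one)
      then have "A #>\<^bsub>?L\<^esub> k = \<one>\<^bsub>?Q\<^esub>"
        using \<psi> kQ Q.one_closed by (auto simp: iso_def bij_betw_def dest: inj_onD)
      then show "k \<in> A" using L.rcos_self[OF kL A.subgroup_axioms] by simp
    qed
  qed
qed

text \<open>
  Along a poly-free series, read from the top, \<open>perfect_subset_free_quotient\<close> pushes the perfect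
  subgroup from each term into the next smaller one, and finally into the trivial group.
\<close>

theorem not_poly_free_if_perfect_derived:
  assumes perfect: "derived G (derived G (carrier G)) = derived G (carrier G)"
    and nontrivial: "derived G (carrier G) \<noteq> {\<one>}" and t: "t \<in> carrier G"
    and cyc: "\<And>g. g \<in> carrier G \<Longrightarrow> \<exists>i :: int. g \<in> derived G (carrier G) #> (t [^] i)"
  shows "\<not> poly_free G"
proof
  let ?K = "derived G (carrier G)"
  assume "poly_free G"
  then obtain n H where H0: "H 0 = {\<one>}" and Hn: "H n = carrier G"
    and H: "\<And>i. i < n \<Longrightarrow> H i \<lhd> G\<lparr>carrier := H (Suc i)\<rparr>"
    and free: "\<And>i. i < n \<Longrightarrow> is_free_group (G\<lparr>carrier := H (Suc i)\<rparr> Mod H i)"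
    by (auto simp: poly_free_def)
  have "subgroup (H i) G \<and> ?K \<subseteq> H i" if "i \<le> n" for i
    using that
  proof (induction rule: inc_induct)
    case base
    then show ?case using Hn subgroup_self derived_in_carrier[of "carrier G"] by simp
  next
    case (step i)
    have H': "subgroup (H (Suc i)) G" "?K \<subseteq> H (Suc i)" using step by auto
    have "subgroup (H i) G"
      using incl_subgroup step H normal_imp_subgroup by blast
    moreover have "?K \<subseteq> H i"
      by (rule perfect_subset_free_quotient[OF derived_self_is_normal perfect t cyc H'
            H[OF step.hyps(2)] free[OF step.hyps(2)]])
    ultimately show ?case ..
  qed
  from this[of 0] have "?K \<subseteq> {\<one>}" using H0 by simp
  moreover have "\<one> \<in> ?K" by (intro subgroup.one_closed derived_is_subgroup) simp
  ultimately show False using nontrivial by blast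
qed

end

section \<open>The geometric representation of a Coxeter group\<close>

text \<open>
  In a basis of simple roots \<open>e\<^sub>i\<close> with \<open>B(e\<^sub>i, e\<^sub>j) = - cos (\<pi> / m i j)\<close> and
  \<open>B(e\<^sub>i, e\<^sub>i) = 1\<close>, the reflection \<open>v \<mapsto> v - 2 B(v, e\<^sub>i) e\<^sub>i\<close> changes only the
  coordinate \<open>i\<close>.
\<close>

definition reflection :: "('a::finite \<Rightarrow> 'a \<Rightarrow> nat) \<Rightarrow> 'a \<Rightarrow> ('a \<Rightarrow> real) \<Rightarrow> 'a \<Rightarrow> real"
  where "reflection m i v = v(i := (\<Sum>j\<in>UNIV - {i}. 2 * cos (pi / m i j) * v j) - v i)"

text \<open>
  While only the reflections \<open>i\<close> and \<open>j\<close> are applied, the other coordinates stay fixed and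
  contribute this constant to the coordinate \<open>i\<close>.
\<close>

definition reflection_pair_sum :: "('a::finite \<Rightarrow> 'a \<Rightarrow> nat) \<Rightarrow> 'a \<Rightarrow> 'a \<Rightarrow> ('a \<Rightarrow> real) \<Rightarrow> real"
  where "reflection_pair_sum m i j v = (\<Sum>k\<in>UNIV - {i, j}. 2 * cos (pi / m i k) * v k)"

lemma reflection_pair:
  assumes "i \<noteq> j"
  shows "reflection m i (v(i := x, j := y)) =
    v(i := 2 * cos (pi / m i j) * y + reflection_pair_sum m i j v - x, j := y)"
proof -
  have "UNIV - {i} = insert j (UNIV - {i, j})" using assms by auto
  then have "(\<Sum>k\<in>UNIV - {i}. 2 * cos (pi / m i k) * (v(i := x, j := y)) k) =
      2 * cos (pi / m i j) * y + (\<Sum>k\<in>UNIV - {i, j}. 2 * cos (pi / m i k) * (v(i := x, j := y)) k)"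
    by simp
  also have "(\<Sum>k\<in>UNIV - {i, j}. 2 * cos (pi / m i k) * (v(i := x, j := y)) k) =
      reflection_pair_sum m i j v"
    unfolding reflection_pair_sum_def by (rule sum.cong) auto
  finally have sum: "(\<Sum>k\<in>UNIV - {i}. 2 * cos (pi / m i k) * (v(i := x, j := y)) k) =
      2 * cos (pi / m i j) * y + reflection_pair_sum m i j v" .
  show ?thesis unfolding reflection_def sum using assms by (simp add: fun_eq_iff)
qed

lemma reflection_involution: "reflection m i (reflection m i v) = v"
proof -
  have "(\<Sum>j\<in>UNIV - {i}. 2 * cos (pi / m i j) * (v(i := x)) j) =
      (\<Sum>j\<in>UNIV - {i}. 2 * cos (pi / m i j) * v j)" for x
    by (rule sum.cong) auto
  then show ?thesis by (simp add: reflection_def)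
qed

lemma bij_reflection: "bij (reflection m i)"
  by (rule o_bij[of "reflection m i"]) (auto simp: reflection_involution)

lemma BijGroup_UNIV_simps:
  "carrier (BijGroup UNIV) = {f. bij f}"
  "bij f \<Longrightarrow> bij g \<Longrightarrow> f \<otimes>\<^bsub>BijGroup UNIV\<^esub> g = f \<circ> g"
  "\<one>\<^bsub>BijGroup UNIV\<^esub> = id"
  by (auto simp: BijGroup_def Bij_def compose_def fun_eq_iff restrict_def)

lemma reflection_in_BijGroup: "reflection m \<in> S \<rightarrow> carrier (BijGroup UNIV)"
  by (simp add: BijGroup_UNIV_simps bij_reflection)

text \<open>
  In the plane of the coordinates \<open>i\<close> and \<open>j\<close>, both maps are affine involutions with common fixed
  point \<open>(x0, y0)\<close>. Relative to it a point has coordinates \<open>(p (- 1/2), p (1/2))\<close>, where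
  \<open>p s = A * cos (s * \<theta>) + B * sin (s * \<theta>)\<close>. As \<open>p (s + 1) = 2 * cos \<theta> * p s - p (s - 1)\<close>, a
  reflection replaces one of two consecutive samples of \<open>p\<close> by the sample on the other side of its
  neighbour, so an alternating word moves the pair of samples by its length. The direction depends on
  which reflection acts first, hence on the parity of \<open>n\<close>: this is the sign \<open>(-1) ^ n\<close>.
\<close>

lemma alternating_reflections:
  fixes m :: "'a::finite \<Rightarrow> 'a \<Rightarrow> nat" and A B x0 y0 \<theta> :: real
  assumes "i \<noteq> j" "m j i = m i j" "\<theta> = pi / m i j"
    and "2 * x0 = 2 * cos \<theta> * y0 + reflection_pair_sum m i j v"
    and "2 * y0 = 2 * cos \<theta> * x0 + reflection_pair_sum m j i v"
    and "v i = x0 + A * cos (\<theta> / 2) - B * sin (\<theta> / 2)"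
    and "v j = y0 + A * cos (\<theta> / 2) + B * sin (\<theta> / 2)"
  shows "word_value (BijGroup UNIV) (reflection m) (alternating i j n) v = v
    (i := x0 + A * cos ((n + 1 / 2) * \<theta>) - (-1) ^ n * B * sin ((n + 1 / 2) * \<theta>),
     j := y0 + A * cos ((n - 1 / 2) * \<theta>) - (-1) ^ n * B * sin ((n - 1 / 2) * \<theta>))"
  using assms
proof (induction n arbitrary: i j x0 y0 B)
  case 0
  then have "v i = x0 + A * cos (\<theta> / 2) - B * sin (\<theta> / 2)"
    and "v j = y0 + A * cos (\<theta> / 2) + B * sin (\<theta> / 2)" by blast+
  then show ?case by (simp add: BijGroup_UNIV_simps fun_eq_iff)
next
  case (Suc n)
  interpret group "BijGroup (UNIV :: ('a \<Rightarrow> real) set)" by (rule group_BijGroup)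
  let ?W = "word_value (BijGroup UNIV) (reflection m)"
  define e :: real where "e = (-1) ^ n"
  define C D where "C s = cos ((n + s) * \<theta>)" and "D s = sin ((n + s) * \<theta>)" for s :: real
  have shift: "(n + 3 / 2) * \<theta> = (n + 1 / 2) * \<theta> + \<theta>" "(n + - 1 / 2) * \<theta> = (n + 1 / 2) * \<theta> - \<theta>"
    by (simp_all add: algebra_simps)
  have C: "2 * cos \<theta> * C (1/2) - C (- 1/2) = C (3/2)" and D: "2 * cos \<theta> * D (1/2) - D (- 1/2) = D (3/2)"
    unfolding C_def D_def shift by (simp_all add: cos_add cos_diff sin_add sin_diff)
  have "bij (?W (alternating j i n))"
    using word_value_closed[OF reflection_in_BijGroup alternating_words, of j UNIV i m n]
    by (simp add: BijGroup_UNIV_simps)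
  then have "?W (alternating i j (Suc n)) v = reflection m i (?W (alternating j i n) v)"
    by (simp add: BijGroup_UNIV_simps bij_reflection)
  also have "?W (alternating j i n) v = v
      (i := x0 + A * C (- 1/2) + e * B * D (- 1/2), j := y0 + A * C (1/2) + e * B * D (1/2))"
  proof -
    have "?W (alternating j i n) v = v
        (j := y0 + A * cos ((n + 1 / 2) * \<theta>) - (-1) ^ n * (- B) * sin ((n + 1 / 2) * \<theta>),
         i := x0 + A * cos ((n - 1 / 2) * \<theta>) - (-1) ^ n * (- B) * sin ((n - 1 / 2) * \<theta>))"
      using Suc.prems by (intro Suc.IH) simp_all
    then show ?thesis using Suc.prems(1) by (simp add: C_def D_def e_def fun_upd_twist)
  qed
  also have "reflection m i \<dots> = v
      (i := x0 + A * C (3/2) + e * B * D (3/2), j := y0 + A * C (1/2) + e * B * D (1/2))"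
  proof -
    have "2 * cos (pi / m i j) * (y0 + A * C (1/2) + e * B * D (1/2)) + reflection_pair_sum m i j v
        - (x0 + A * C (- 1/2) + e * B * D (- 1/2)) =
      x0 + A * (2 * cos \<theta> * C (1/2) - C (- 1/2)) + e * B * (2 * cos \<theta> * D (1/2) - D (- 1/2))"
      using Suc.prems(3,4) by (simp add: algebra_simps)
    then show ?thesis by (simp only: reflection_pair[OF Suc.prems(1)] C D)
  qed
  finally have "?W (alternating i j (Suc n)) v = v
      (i := x0 + A * C (3/2) + e * B * D (3/2), j := y0 + A * C (1/2) + e * B * D (1/2))" .
  moreover have "real (Suc n) + 1 / 2 = n + 3 / 2" "real (Suc n) - 1 / 2 = n + 1 / 2"
    by simp_all
  moreover have "a - (-1) ^ Suc n * B * b = a + e * B * b" for a b :: real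
    by (simp add: e_def)
  ultimately show ?case by (simp only: C_def D_def)
qed

text \<open>
  For \<open>n = m i j\<close> the two words move the samples by the angle \<open>n * \<theta> = \<pi>\<close> in opposite directions.
  Shifts by \<open>\<pi>\<close> and by \<open>- \<pi>\<close> both change \<open>p\<close> into \<open>- p\<close>, so the words act in the same way.
\<close>

lemma reflection_relation:
  fixes m :: "'a::finite \<Rightarrow> 'a \<Rightarrow> nat"
  assumes ij: "i \<noteq> j" and sym: "m j i = m i j" and m: "m i j \<ge> 2"
  shows "word_value (BijGroup UNIV) (reflection m) (alternating i j (m i j)) =
    word_value (BijGroup UNIV) (reflection m) (alternating j i (m i j))"
proof
  fix v :: "'a \<Rightarrow> real"
  define \<theta> where "\<theta> = pi / m i j"
  have \<theta>: "0 < \<theta>" "\<theta> < pi" "m i j * \<theta> = pi" using m by (auto simp: \<theta>_def field_simps)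
  have cs: "cos (\<theta> / 2) > 0" "sin (\<theta> / 2) > 0" "sin \<theta> > 0"
    using \<theta> by (auto intro!: cos_gt_zero sin_gt_zero)
  define \<delta> \<epsilon> where "\<delta> = reflection_pair_sum m i j v" and "\<epsilon> = reflection_pair_sum m j i v"
  \<comment> \<open>the solution of the two fixed point equations \<open>fix_x\<close> and \<open>fix_y\<close>; its denominator is nonzero as \<open>0 < \<theta> < \<pi>\<close>\<close>
  define x0 y0 where "x0 = (\<delta> + cos \<theta> * \<epsilon>) / (2 * (sin \<theta>)\<^sup>2)" and "y0 = (\<epsilon> + cos \<theta> * \<delta>) / (2 * (sin \<theta>)\<^sup>2)"
  define A B where "A = (v j - y0 + (v i - x0)) / (2 * cos (\<theta> / 2))"
    and "B = (v j - y0 - (v i - x0)) / (2 * sin (\<theta> / 2))"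
  have cos2: "(cos \<theta>)\<^sup>2 = 1 - (sin \<theta>)\<^sup>2" by (simp add: cos_squared_eq)
  have fix_x: "2 * x0 = 2 * cos \<theta> * y0 + \<delta>"
  proof -
    have "2 * cos \<theta> * y0 + \<delta> = (cos \<theta> * \<epsilon> + (cos \<theta>)\<^sup>2 * \<delta> + (sin \<theta>)\<^sup>2 * \<delta>) / (sin \<theta>)\<^sup>2"
      using cs(3) by (simp add: y0_def field_simps power2_eq_square)
    also have "\<dots> = 2 * x0" using cs(3) by (simp add: cos2 x0_def field_simps)
    finally show ?thesis by simp
  qed
  have fix_y: "2 * y0 = 2 * cos \<theta> * x0 + \<epsilon>"
  proof -
    have "2 * cos \<theta> * x0 + \<epsilon> = (cos \<theta> * \<delta> + (cos \<theta>)\<^sup>2 * \<epsilon> + (sin \<theta>)\<^sup>2 * \<epsilon>) / (sin \<theta>)\<^sup>2"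
      using cs(3) by (simp add: x0_def field_simps power2_eq_square)
    also have "\<dots> = 2 * y0" using cs(3) by (simp add: cos2 y0_def field_simps)
    finally show ?thesis by simp
  qed
  have vi: "v i = x0 + A * cos (\<theta> / 2) - B * sin (\<theta> / 2)"
    and vj: "v j = y0 + A * cos (\<theta> / 2) + B * sin (\<theta> / 2)"
    using cs by (simp_all add: A_def B_def field_simps)
  have half: "(m i j + 1 / 2) * \<theta> = pi + \<theta> / 2" "(m i j - 1 / 2) * \<theta> = pi - \<theta> / 2"
    using \<theta>(3) by (simp_all add: algebra_simps)
  let ?W = "word_value (BijGroup UNIV) (reflection m)"
  show "?W (alternating i j (m i j)) v = ?W (alternating j i (m i j)) v"
  proof -
    define e :: real where "e = (-1) ^ m i j"
    have "?W (alternating i j (m i j)) v =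
      v(i := x0 - A * cos (\<theta> / 2) + e * B * sin (\<theta> / 2), j := y0 - A * cos (\<theta> / 2) - e * B * sin (\<theta> / 2))"
      using alternating_reflections[OF ij sym \<theta>_def fix_x[unfolded \<delta>_def] fix_y[unfolded \<epsilon>_def] vi vj, of "m i j"]
      by (simp only: half) (simp add: e_def)
    moreover have "?W (alternating j i (m i j)) v =
      v(j := y0 - A * cos (\<theta> / 2) - e * B * sin (\<theta> / 2), i := x0 - A * cos (\<theta> / 2) + e * B * sin (\<theta> / 2))"
      using alternating_reflections[OF ij[symmetric] sym[symmetric] \<theta>_def[folded sym] fix_y[unfolded \<epsilon>_def]
          fix_x[unfolded \<delta>_def], of A "- B" "m i j"] vi vj
      by (simp only: half) (simp add: e_def)
    ultimately show ?thesis using ij by (simp add: fun_upd_twist)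
  qed
qed

lemma reflections_noncommuting:
  fixes m :: "'a::finite \<Rightarrow> 'a \<Rightarrow> nat"
  assumes ij: "i \<noteq> j" and sym: "m j i = m i j" and m: "m i j \<ge> 3"
  shows "reflection m i \<circ> reflection m j \<noteq> reflection m j \<circ> reflection m i"
proof
  assume eq: "reflection m i \<circ> reflection m j = reflection m j \<circ> reflection m i"
  define c where "c = 2 * cos (pi / m i j)"
  have "cos (pi / m i j) > 0" using m by (intro cos_gt_zero) (auto simp: field_simps)
  then have "c > 0" by (simp add: c_def)
  let ?v = "(\<lambda>_. 0)(i := 1, j := 0 :: real)"
  have zero: "reflection_pair_sum m k l (\<lambda>_. 0) = 0" for k l by (simp add: reflection_pair_sum_def)
  have swap: "(\<lambda>_. 0)(i := x, j := y) = (\<lambda>_. 0)(j := y, i := x :: real)" for x y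
    using ij by auto
  have i: "reflection m i ((\<lambda>_. 0)(i := x, j := y)) = (\<lambda>_. 0)(i := c * y - x, j := y)" for x y
    using ij by (simp add: reflection_pair zero c_def)
  have j: "reflection m j ((\<lambda>_. 0)(i := x, j := y)) = (\<lambda>_. 0)(i := x, j := c * x - y)" for x y
    using ij sym unfolding swap by (simp add: reflection_pair zero c_def)
  have "(reflection m i \<circ> reflection m j) ?v = (\<lambda>_. 0)(i := c * c - 1, j := c)" by (simp only: o_def i j) simp
  moreover have "(reflection m j \<circ> reflection m i) ?v = (\<lambda>_. 0)(i := - 1, j := - c)" by (simp only: o_def i j) simp
  ultimately have "c = - c" using eq by (metis fun_upd_same)
  with \<open>c > 0\<close> show False by simp
qed

section \<open>Triangle Artin groups\<close>

instance artin_gen :: finite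
proof
  have "(UNIV :: artin_gen set) = {Gen_a, Gen_b, Gen_c}" using artin_gen.exhaust by blast
  then show "finite (UNIV :: artin_gen set)" by (metis finite.emptyI finite.insertI)
qed

definition triangle_relations :: "nat \<Rightarrow> nat \<Rightarrow> nat \<Rightarrow> (artin_gen word \<times> artin_gen word) set"
  where "triangle_relations M N P =
    {(alternating Gen_a Gen_b M, alternating Gen_b Gen_a M),
     (alternating Gen_b Gen_c N, alternating Gen_c Gen_b N),
     (alternating Gen_c Gen_a P, alternating Gen_a Gen_c P)}"

abbreviation triangle_gen :: "nat \<Rightarrow> nat \<Rightarrow> nat \<Rightarrow> artin_gen \<Rightarrow> artin_gen word set set"
  where "triangle_gen M N P \<equiv> presented_gen {Gen_a, Gen_b, Gen_c} (triangle_relations M N P)"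

lemma triangle_artin_presented:
  "triangle_artin M N P = presented_group {Gen_a, Gen_b, Gen_c} (triangle_relations M N P)"
  by (simp add: triangle_artin_def triangle_relations_def)

lemma triangle_relations_words:
  "(l, r) \<in> triangle_relations M N P \<Longrightarrow>
    l \<in> words {Gen_a, Gen_b, Gen_c} \<and> r \<in> words {Gen_a, Gen_b, Gen_c}"
  by (auto simp: triangle_relations_def intro: alternating_words)

definition coxeter_triangle :: "nat \<Rightarrow> nat \<Rightarrow> nat \<Rightarrow> artin_gen \<Rightarrow> artin_gen \<Rightarrow> nat"
  where "coxeter_triangle M N P x y =
    (if {x, y} = {Gen_a, Gen_b} then M else if {x, y} = {Gen_b, Gen_c} then N else P)"

lemma coxeter_triangle_sym: "coxeter_triangle M N P x y = coxeter_triangle M N P y x"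
  by (simp add: coxeter_triangle_def insert_commute)

lemma coxeter_triangle_simps:
  "coxeter_triangle M N P Gen_a Gen_b = M" "coxeter_triangle M N P Gen_b Gen_c = N"
  "coxeter_triangle M N P Gen_c Gen_a = P"
  by (auto simp: coxeter_triangle_def doubleton_eq_iff)

text \<open>
  The geometric representation satisfies the relations of the Artin group and separates the two
  products.
\<close>

lemma triangle_gens_noncommuting:
  assumes MNP: "M \<ge> 2" "N \<ge> 2" "P \<ge> 2"
    and xy: "x \<noteq> y" "coxeter_triangle M N P x y \<ge> 3"
  shows "triangle_gen M N P x \<otimes>\<^bsub>triangle_artin M N P\<^esub> triangle_gen M N P y \<noteq>
    triangle_gen M N P y \<otimes>\<^bsub>triangle_artin M N P\<^esub> triangle_gen M N P x"
proof
  let ?S = "{Gen_a, Gen_b, Gen_c}" and ?R = "triangle_relations M N P"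
    and ?T = "BijGroup (UNIV :: (artin_gen \<Rightarrow> real) set)" and ?m = "coxeter_triangle M N P"
  interpret G: group "presented_group ?S ?R"
    by (rule group_presented) (rule triangle_relations_words)
  have xyS: "x \<in> ?S" "y \<in> ?S" by (cases x; simp) (cases y; simp)
  have gens: "triangle_gen M N P z \<in> carrier (presented_group ?S ?R)" if "z \<in> ?S" for z
    using presented_gen_closed[of ?R ?S] triangle_relations_words that by blast
  assume "triangle_gen M N P x \<otimes>\<^bsub>triangle_artin M N P\<^esub> triangle_gen M N P y =
    triangle_gen M N P y \<otimes>\<^bsub>triangle_artin M N P\<^esub> triangle_gen M N P x"
  then have equal: "word_value (presented_group ?S ?R) (triangle_gen M N P) [(x, True), (y, True)] =
      word_value (presented_group ?S ?R) (triangle_gen M N P) [(y, True), (x, True)]"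
    using gens xyS by (simp add: triangle_artin_presented)
  have rel: "word_value ?T (reflection ?m) l = word_value ?T (reflection ?m) r"
    if "(l, r) \<in> ?R" for l r
  proof -
    have braid: "word_value ?T (reflection ?m) (alternating i j n) =
        word_value ?T (reflection ?m) (alternating j i n)" if "?m i j = n" "i \<noteq> j" "n \<ge> 2" for i j n
      using reflection_relation[where m = ?m, OF that(2) coxeter_triangle_sym] that by simp
    have "?m Gen_a Gen_b = M" "?m Gen_b Gen_c = N" "?m Gen_c Gen_a = P"
      by (rule coxeter_triangle_simps)+
    from braid[OF this(1) _ MNP(1)] braid[OF this(2) _ MNP(2)] braid[OF this(3) _ MNP(3)]
    show ?thesis using that unfolding triangle_relations_def by (elim insertE) simp_all
  qed
  have "word_value ?T (reflection ?m) [(x, True), (y, True)] =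
      word_value ?T (reflection ?m) [(y, True), (x, True)]"
    by (rule presented_group_universal[OF triangle_relations_words group_BijGroup
          reflection_in_BijGroup rel _ _ equal]) (use xyS in simp_all)
  then have "reflection ?m x \<circ> reflection ?m y = reflection ?m y \<circ> reflection ?m x"
    by (simp add: BijGroup_UNIV_simps bij_reflection)
  with reflections_noncommuting[OF xy(1) coxeter_triangle_sym xy(2)] show False by simp
qed

theorem theorem1p7:
  fixes M N P :: nat
  assumes "M \<ge> 2" and "N \<ge> 2" and "P \<ge> 2"
    and "coprime M N" and "coprime N P" and "coprime M P"
  shows "perfect_group (commutator_subgroup (triangle_artin M N P))
    \<and> \<not> poly_free (triangle_artin M N P)"
proof -
  let ?S = "{Gen_a, Gen_b, Gen_c}" and ?R = "triangle_relations M N P"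
  let ?G = "triangle_artin M N P" and ?f = "triangle_gen M N P"
  interpret G: group ?G by (rule group_triangle_artin)
  note rel_words = triangle_relations_words[of _ _ M N P]
  have f: "?f \<in> ?S \<rightarrow> carrier ?G"
    using presented_gen_closed[of ?R ?S] rel_words by (simp add: triangle_artin_presented)
  have gens: "?f Gen_a \<in> carrier ?G" "?f Gen_b \<in> carrier ?G" "?f Gen_c \<in> carrier ?G"
    using f by auto
  have relation: "word_value ?G ?f l = word_value ?G ?f r" if "(l, r) \<in> ?R" for l r
    using presented_group_relation[of ?R ?S, OF rel_words that] by (simp add: triangle_artin_presented)
  \<comment> \<open>The differences of the generators descend from one term of the derived series to the next.\<close>
  have descend: "?f Gen_b \<otimes>\<^bsub>?G\<^esub> inv\<^bsub>?G\<^esub> ?f Gen_a \<in> derived ?G B \<and>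
      ?f Gen_c \<otimes>\<^bsub>?G\<^esub> inv\<^bsub>?G\<^esub> ?f Gen_b \<in> derived ?G B"
    if "B \<lhd> ?G" "?f Gen_b \<otimes>\<^bsub>?G\<^esub> inv\<^bsub>?G\<^esub> ?f Gen_a \<in> B" "?f Gen_c \<otimes>\<^bsub>?G\<^esub> inv\<^bsub>?G\<^esub> ?f Gen_b \<in> B" for B
    by (rule G.triangle_relations_derived[where f = ?f, OF that(1) gens that(2,3) _ _ _ assms(4-6)];
        rule relation; simp add: triangle_relations_def)
  have cyclic: "\<exists>i :: int. g \<in> B #>\<^bsub>?G\<^esub> (?f Gen_a [^]\<^bsub>?G\<^esub> i)"
    if B: "B \<lhd> ?G" and ba: "?f Gen_b \<otimes>\<^bsub>?G\<^esub> inv\<^bsub>?G\<^esub> ?f Gen_a \<in> B"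
      and cb: "?f Gen_c \<otimes>\<^bsub>?G\<^esub> inv\<^bsub>?G\<^esub> ?f Gen_b \<in> B" and g: "g \<in> carrier ?G" for B g
  proof -
    interpret B: normal B ?G by fact
    obtain w where w: "w \<in> words ?S" "g = word_value ?G ?f w"
      using presented_group_generated[of ?R ?S, OF rel_words] g
      unfolding triangle_artin_presented by blast
    have "(?f Gen_c \<otimes>\<^bsub>?G\<^esub> inv\<^bsub>?G\<^esub> ?f Gen_b) \<otimes>\<^bsub>?G\<^esub> (?f Gen_b \<otimes>\<^bsub>?G\<^esub> inv\<^bsub>?G\<^esub> ?f Gen_a) =
        ?f Gen_c \<otimes>\<^bsub>?G\<^esub> inv\<^bsub>?G\<^esub> ?f Gen_a"
      using gens by (simp add: G.m_assoc) (simp add: G.m_assoc[symmetric])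
    then have ca: "?f Gen_c \<otimes>\<^bsub>?G\<^esub> inv\<^bsub>?G\<^esub> ?f Gen_a \<in> B" using B.m_closed[OF cb ba] by simp
    have "?f x \<otimes>\<^bsub>?G\<^esub> inv\<^bsub>?G\<^esub> ?f Gen_a \<in> B" if "x \<in> ?S" for x
      using that ba ca gens by auto
    from G.word_value_modulo_normal[OF B f gens(1) this w(1)] show ?thesis by (simp add: w(2))
  qed
  let ?K = "derived ?G (carrier ?G)"
  have K: "?K \<lhd> ?G" by (rule G.derived_self_is_normal)
  have K': "derived ?G ?K \<lhd> ?G" by (rule G.derived_is_normal[OF K])

  have in_K: "?f Gen_b \<otimes>\<^bsub>?G\<^esub> inv\<^bsub>?G\<^esub> ?f Gen_a \<in> ?K" "?f Gen_c \<otimes>\<^bsub>?G\<^esub> inv\<^bsub>?G\<^esub> ?f Gen_b \<in> ?K"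
    using descend[OF G.normal_self] gens by simp_all
  have perfect: "derived ?G ?K = ?K"
  proof
    show "derived ?G ?K \<subseteq> ?K"
      by (rule G.derived_incl[OF subset_refl normal_imp_subgroup[OF K]])
    show "?K \<subseteq> derived ?G ?K"
      using descend[OF K in_K] cyclic[OF K']
      by (intro G.derived_subset_if_cyclic_quotient[OF K' gens(1)]) blast
  qed
  have "perfect_group (commutator_subgroup ?G)"
    using G.subgroup_imp_group[OF normal_imp_subgroup[OF K]] perfect
      G.derived_consistent[OF subset_refl normal_imp_subgroup[OF K]]
    by (simp add: perfect_group_def)
  moreover have "?K \<noteq> {\<one>\<^bsub>?G\<^esub>}"
  proof
    assume trivial: "?K = {\<one>\<^bsub>?G\<^esub>}"
    have commute: "g \<otimes>\<^bsub>?G\<^esub> h = h \<otimes>\<^bsub>?G\<^esub> g" if "g \<in> carrier ?G" "h \<in> carrier ?G" for g h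
    proof -
      have "g \<otimes>\<^bsub>?G\<^esub> h \<otimes>\<^bsub>?G\<^esub> inv\<^bsub>?G\<^esub> g \<otimes>\<^bsub>?G\<^esub> inv\<^bsub>?G\<^esub> h \<in> ?K"
        unfolding derived_def using that by (intro generate.incl) auto
      then have "(g \<otimes>\<^bsub>?G\<^esub> h) \<otimes>\<^bsub>?G\<^esub> inv\<^bsub>?G\<^esub> (h \<otimes>\<^bsub>?G\<^esub> g) = \<one>\<^bsub>?G\<^esub>"
        using trivial that by (simp add: G.inv_mult_group G.m_assoc)
      then show ?thesis
        using G.inv_equality[of "g \<otimes>\<^bsub>?G\<^esub> h" "inv\<^bsub>?G\<^esub> (h \<otimes>\<^bsub>?G\<^esub> g)"] that by simp
    qed
    \<comment> \<open>\<open>M\<close> and \<open>N\<close> are coprime, so they are not both \<open>2\<close>.\<close>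
    have "M \<ge> 3 \<or> N \<ge> 3"
      using assms(1,2,4) by (cases "M = 2"; cases "N = 2") auto
    then show False
      using triangle_gens_noncommuting[OF assms(1-3), of Gen_a Gen_b]
        triangle_gens_noncommuting[OF assms(1-3), of Gen_b Gen_c] commute gens
      by (auto simp: coxeter_triangle_simps)
  qed
  ultimately show ?thesis
    using G.not_poly_free_if_perfect_derived[OF perfect _ gens(1) cyclic[OF K in_K]] by blast
qed

end
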